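(* Let $V$ be a vertex algebra, let $N'\xrightarrow{f}N\xrightarrow{g}N''\to0$ be an exact sequence of $V$-modules and $V$-homomorphisms, and let $M$ be a $V$-module; assume that the tensor products $M\otimes_VN'$, $M\otimes_VN$ and $M\otimes_VN''$ exist. Then $$M\otimes_VN'\xrightarrow{1_M\otimes f}M\otimes_VN\xrightarrow{1_M\otimes g}M\otimes_VN''\to0$$ is an exact sequence of $V$-modules.
   Context: All vector spaces are over an algebraically closed field $\mathbf k$ of characteristic $0$. For $n\in\mathbb Z$, $(x+y)^n:=\sum_{k\ge 0}\binom nk x^{n-k}y^k$, i.e. binomials are expanded in nonnegative powers of the second-listed variable; a series evaluated at $z+x$, $z-x$, etc. is expanded by this rule. Vertex algebra: a vector space $V$ with a linear map $V\otimes V\to V((z))$, $a\otimes b\mapsto a_{\dot z}b=\sum_{n}(a_nb)z^{-n-1}$, a vector $\mathbf 1\in V$ and $d\in\mathrm{End}(V)$ such that for $a,b,c\in V$: $\mathbf 1_{\dot z}a=a$, $a_{\dot z}\mathbf 1=e^{zd}a$; $(da)_{\dot z}b=\frac{d}{dz}(a_{\dot z}b)$, $d(a_{\dot z}b)=(da)_{\dot z}b+a_{\dot z}(db)$; $a_{\dot z}b=e^{zd}(b_{\dot{-z}}a)$; and there is $l\in\mathbb N$ with $(z+w)^l(a_{\dot z}b)_{\dot w}c=(z+w)^l a_{\dot{z+w}}(b_{\dot w}c)$. $V$-module: a vector space $M$ with $d\in\mathrm{End}(M)$ and a linear map $V\otimes M\to M((z))$, $a\otimes u\mapsto a_{\dot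 z}u$, such that $\mathbf 1_{\dot z}u=u$; $(da)_{\dot z}u=\frac{d}{dz}(a_{\dot z}u)$, $d(a_{\dot z}u)=(da)_{\dot z}u+a_{\dot z}(du)$; and for all $a,b\in V$, $u\in M$ there is $l\in\mathbb N$ with $(z+x)^l(a_{\dot z}b)_{\dot x}u=(z+x)^la_{\dot{z+x}}(b_{\dot x}u)$. A $V$-homomorphism is a linear map $\varphi$ with $\varphi(a_{\dot z}u)=a_{\dot z}\varphi(u)$ and $\varphi(du)=d\varphi(u)$. Vertex bilinear map of type $(M,N;W)$: a bilinear map $F_z:M\times N\to W((z))$ with $F_z(du,v)=\frac{d}{dz}F_z(u,v)$, $F_z(u,dv)=(d-\frac{d}{dz})F_z(u,v)$, and such that for all $a\in V,u\in M,v\in N$ there are $n,k\in\mathbb N$ with $(z+x)^na_{\dot{z+x}}F_x(u,v)=(z+x)^nF_x(a_{\dot z}u,v)$ and $(z-x)^ka_{\dot z}F_x(u,v)=(z-x)^kF_x(u,a_{\dot z}v)$. Tensor product of $(M,N)$: a $V$-module $M\otimes_VN$ with a vertex bilinear map of type $(M,N;M\otimes_VN)$, written $(u,v)\mapsto u\otimes_zv\in(M\otimes_VN)((z))$, such that for every $V$-module $W$ and vertex bilinear map $I_z$ of type $(M,N;W)$ there is a unique $V$-homomorphism $\varphi:M\otimes_VN\to W$ with $I_z(u,v)=\varphi(u\otimes_zv)$ (homomorphisms are extended coefficientwise). For a $V$-homomorphism $g:N\to N'$, $1_M\otimes g:M\otimes_VN\to M\otimes_VN'$ is the unique $V$-homomorphism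 with $(1_M\otimes g)(u\otimes_zv)=u\otimes_zg(v)$. *)

theory Defs
  imports "HOL-Algebra.Algebraic_Closure"
begin

section \<open>Formal series with coefficients in a vector space\<close>

text \<open>
  Vector spaces are modules over a field in the sense of \<^theory>\<open>HOL-Algebra.Module\<close>.  A formal series
  in one variable is its family of coefficients \<^typ>\<open>int \<Rightarrow> 'w\<close> (coefficient of \<open>z^n\<close> at \<open>n\<close>), a
  formal series in two variables is a family \<^typ>\<open>int \<Rightarrow> int \<Rightarrow> 'w\<close> (coefficient of \<open>z^p x^q\<close>
  at \<open>p q\<close>), unrestricted in both directions.
\<close>

locale alg_closed_char_0 = algebraically_closed K for K (structure) +
  assumes char_0: "\<And>n::nat. n > 0 \<Longrightarrow> [n] \<cdot>\<^bsub>K\<^esub> \<one>\<^bsub>K\<^esub> \<noteq> \<zero>\<^bsub>K\<^esub>"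

definition linear_maps ::
  "('k, 'c) ring_scheme \<Rightarrow> ('k, 'a, 'd) module_scheme \<Rightarrow> ('k, 'b, 'e) module_scheme \<Rightarrow> ('a \<Rightarrow> 'b) set"
  where "linear_maps K A B =
    {\<phi> \<in> carrier A \<rightarrow> carrier B.
       (\<forall>x\<in>carrier A. \<forall>y\<in>carrier A. \<phi> (x \<oplus>\<^bsub>A\<^esub> y) = \<phi> x \<oplus>\<^bsub>B\<^esub> \<phi> y) \<and>
       (\<forall>c\<in>carrier K. \<forall>x\<in>carrier A. \<phi> (c \<odot>\<^bsub>A\<^esub> x) = c \<odot>\<^bsub>B\<^esub> \<phi> x)}"

text \<open>The space \<open>W((z))\<close>.\<close>

definition laurent :: "('w, 'd) ring_scheme \<Rightarrow> (int \<Rightarrow> 'w) set"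
  where "laurent W = {f. (\<forall>n. f n \<in> carrier W) \<and> (\<exists>N. \<forall>n<N. f n = \<zero>\<^bsub>W\<^esub>)}"

definition laurent_bilinear ::
  "('k, 'c) ring_scheme \<Rightarrow> ('k, 'a, 'd) module_scheme \<Rightarrow> ('k, 'b, 'e) module_scheme \<Rightarrow>
   ('k, 'w, 'f) module_scheme \<Rightarrow> ('a \<Rightarrow> 'b \<Rightarrow> int \<Rightarrow> 'w) \<Rightarrow> bool"
  where "laurent_bilinear K A B W F \<longleftrightarrow>
    (\<forall>a\<in>carrier A. \<forall>b\<in>carrier B. F a b \<in> laurent W) \<and>
    (\<forall>b\<in>carrier B. \<forall>n. (\<lambda>a. F a b n) \<in> linear_maps K A W) \<and>
    (\<forall>a\<in>carrier A. \<forall>n. (\<lambda>b. F a b n) \<in> linear_maps K B W)"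

definition const_series :: "('w, 'd) ring_scheme \<Rightarrow> 'w \<Rightarrow> int \<Rightarrow> 'w"
  where "const_series W w = (\<lambda>n. if n = 0 then w else \<zero>\<^bsub>W\<^esub>)"

definition deriv_series :: "('w, 'd) ring_scheme \<Rightarrow> (int \<Rightarrow> 'w) \<Rightarrow> int \<Rightarrow> 'w"
  where "deriv_series W f = (\<lambda>n. [(n + 1)] \<cdot>\<^bsub>W\<^esub> f (n + 1))"

text \<open>Sum of a family with finitely many nonzero members, over an arbitrary index type.\<close>

definition support_sum :: "('w, 'd) ring_scheme \<Rightarrow> ('i \<Rightarrow> 'w) \<Rightarrow> 'w"
  where "support_sum W h = finsum W h {i. h i \<noteq> \<zero>\<^bsub>W\<^esub>}"

text \<open>\<open>e^(zd) f(z)\<close>; the sum is finite for \<open>f\<close> in \<open>W((z))\<close>.\<close>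

definition exp_series ::
  "('k, 'c) ring_scheme \<Rightarrow> ('k, 'w, 'd) module_scheme \<Rightarrow> ('w \<Rightarrow> 'w) \<Rightarrow> (int \<Rightarrow> 'w) \<Rightarrow> int \<Rightarrow> 'w"
  where "exp_series K W d f =
    (\<lambda>n. support_sum W (\<lambda>j::nat.
       inv\<^bsub>K\<^esub> ([(fact j :: nat)] \<cdot>\<^bsub>K\<^esub> \<one>\<^bsub>K\<^esub>) \<odot>\<^bsub>W\<^esub> (d ^^ j) (f (n - int j))))"

text \<open>\<open>f(-z)\<close>.\<close>

definition at_neg :: "('w, 'd) ring_scheme \<Rightarrow> (int \<Rightarrow> 'w) \<Rightarrow> int \<Rightarrow> 'w"
  where "at_neg W f = (\<lambda>n. if even n then f n else \<ominus>\<^bsub>W\<^esub> f n)"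

text \<open>
  The binomial coefficient with integer upper argument (the division is exact).  The library's
  \<open>gchoose\<close> is constrained to fields on input, hence not applicable to integers.
\<close>

definition int_binom :: "int \<Rightarrow> nat \<Rightarrow> int"
  where "int_binom n k = (\<Prod>i=0..<k. n - int i) div fact k"

text \<open>
  \<open>f(z+x)\<close>, expanded in nonnegative powers of \<open>x\<close>: the coefficient of \<open>z^p x^q\<close> in
  \<open>\<Sum>i. f_i (z+x)^i = \<Sum>i. \<Sum>q\<ge>0. binom(i,q) f_i z^(i-q) x^q\<close> comes from \<open>i = p + q\<close> only.
\<close>

definition at_plus :: "('w, 'd) ring_scheme \<Rightarrow> (int \<Rightarrow> 'w) \<Rightarrow> int \<Rightarrow> int \<Rightarrow> 'w"
  where "at_plus W f =
    (\<lambda>p q. if q < 0 then \<zero>\<^bsub>W\<^esub> else [(int_binom (p + q) (nat q))] \<cdot>\<^bsub>W\<^esub> f (p + q))"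

text \<open>
  Multiplication by \<open>z+x\<close> and by \<open>z-x\<close>; multiplication by \<open>(z+x)^l\<close> and \<open>(z-x)^l\<close>, for \<open>l\<close> a natural
  number, is the \<open>l\<close>-th iterate.
\<close>

definition mult_plus ::
  "('w, 'd) ring_scheme \<Rightarrow> (int \<Rightarrow> int \<Rightarrow> 'w) \<Rightarrow> int \<Rightarrow> int \<Rightarrow> 'w"
  where "mult_plus W G = (\<lambda>p q. G (p - 1) q \<oplus>\<^bsub>W\<^esub> G p (q - 1))"

definition mult_minus ::
  "('w, 'd) ring_scheme \<Rightarrow> (int \<Rightarrow> int \<Rightarrow> 'w) \<Rightarrow> int \<Rightarrow> int \<Rightarrow> 'w"
  where "mult_minus W G = (\<lambda>p q. G (p - 1) q \<ominus>\<^bsub>W\<^esub> G p (q - 1))"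


section \<open>Vertex algebras and their modules\<close>

text \<open>
  \<open>vop M a u n\<close> is the coefficient of \<open>z^n\<close> in \<open>a_z u\<close>, that is \<open>a_(-n-1) u\<close> in mode notation.
  The fields \<open>mult\<close> and \<open>one\<close>, which \<^type>\<open>module\<close> inherits from rings, are irrelevant.
  A vertex algebra carries the same data as a module over itself, and a vacuum vector.
\<close>

record ('k, 'v, 'm) vmodule = "('k, 'm) module" +
  transl :: "'m \<Rightarrow> 'm"
  vop :: "'v \<Rightarrow> 'm \<Rightarrow> int \<Rightarrow> 'm"

record ('k, 'v) valgebra = "('k, 'v, 'v) vmodule" +
  vac :: 'v

text \<open>
  \<open>a_(z+x) F(x)\<close> for \<open>F\<close> in \<open>W((x))\<close>: the sum over \<open>m\<close> of \<open>x^m\<close> times \<open>(a_(z+x) F_m)\<close>.  Only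
  \<open>m \<le> q\<close> with \<open>F_m \<noteq> 0\<close> contribute to the coefficient of \<open>z^p x^q\<close>.
\<close>

definition vop_at_plus ::
  "('k, 'v, 'w, 'd) vmodule_scheme \<Rightarrow> 'v \<Rightarrow> (int \<Rightarrow> 'w) \<Rightarrow> int \<Rightarrow> int \<Rightarrow> 'w"
  where "vop_at_plus W a F =
    (\<lambda>p q. support_sum W (\<lambda>m. at_plus W (vop W a (F m)) p (q - m)))"

locale vertex_algebra = K?: alg_closed_char_0 K + module K V
  for K :: "('k, 'c) ring_scheme" (structure) and V :: "('k, 'v, 'd) valgebra_scheme" +
  assumes vop_laurent_bilinear: "laurent_bilinear K V V V (vop V)"
    and vac_closed: "vac V \<in> carrier V"
    and transl_linear: "transl V \<in> linear_maps K V V"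
    and vac_left: "a \<in> carrier V \<Longrightarrow> vop V (vac V) a = const_series V a"
    and vac_right: "a \<in> carrier V \<Longrightarrow>
      vop V a (vac V) = exp_series K V (transl V) (const_series V a)"
    and vop_transl: "\<lbrakk>a \<in> carrier V; b \<in> carrier V\<rbrakk> \<Longrightarrow>
      vop V (transl V a) b = deriv_series V (vop V a b)"
    and transl_vop: "\<lbrakk>a \<in> carrier V; b \<in> carrier V\<rbrakk> \<Longrightarrow>
      transl V (vop V a b n) = vop V (transl V a) b n \<oplus>\<^bsub>V\<^esub> vop V a (transl V b) n"
    and skew_symmetry: "\<lbrakk>a \<in> carrier V; b \<in> carrier V\<rbrakk> \<Longrightarrow>
      vop V a b = exp_series K V (transl V) (at_neg V (vop V b a))"
    and weak_assoc: "\<lbrakk>a \<in> carrier V; b \<in> carrier V; c \<in> carrier V\<rbrakk> \<Longrightarrow>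
      \<exists>l. (mult_plus V ^^ l) (\<lambda>p. vop V (vop V a b p) c)
        = (mult_plus V ^^ l) (vop_at_plus V a (vop V b c))"

locale vertex_module = V?: vertex_algebra K V + M: module K M
  for K :: "('k, 'c) ring_scheme" (structure) and V :: "('k, 'v, 'd) valgebra_scheme"
    and M :: "('k, 'v, 'm, 'e) vmodule_scheme" +
  assumes act_laurent_bilinear: "laurent_bilinear K V M M (vop M)"
    and mod_transl_linear: "transl M \<in> linear_maps K M M"
    and act_vac: "u \<in> carrier M \<Longrightarrow> vop M (vac V) u = const_series M u"
    and act_transl: "\<lbrakk>a \<in> carrier V; u \<in> carrier M\<rbrakk> \<Longrightarrow>
      vop M (transl V a) u = deriv_series M (vop M a u)"
    and transl_act: "\<lbrakk>a \<in> carrier V; u \<in> carrier M\<rbrakk> \<Longrightarrow>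
      transl M (vop M a u n) = vop M (transl V a) u n \<oplus>\<^bsub>M\<^esub> vop M a (transl M u) n"
    and act_assoc: "\<lbrakk>a \<in> carrier V; b \<in> carrier V; u \<in> carrier M\<rbrakk> \<Longrightarrow>
      \<exists>l. (mult_plus M ^^ l) (\<lambda>p. vop M (vop V a b p) u)
        = (mult_plus M ^^ l) (vop_at_plus M a (vop M b u))"

definition vertex_hom ::
  "('k, 'c) ring_scheme \<Rightarrow> ('k, 'v, 'd) valgebra_scheme \<Rightarrow> ('k, 'v, 'm, 'e) vmodule_scheme \<Rightarrow>
   ('k, 'v, 'n, 'f) vmodule_scheme \<Rightarrow> ('m \<Rightarrow> 'n) set"
  where "vertex_hom K V M N =
    {\<phi> \<in> linear_maps K M N.
       (\<forall>a\<in>carrier V. \<forall>u\<in>carrier M. \<forall>n. \<phi> (vop M a u n) = vop N a (\<phi> u) n) \<and>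
       (\<forall>u\<in>carrier M. \<phi> (transl M u) = transl N (\<phi> u))}"

definition right_exact ::
  "('k, 'c) ring_scheme \<Rightarrow> ('k, 'v, 'd) valgebra_scheme \<Rightarrow> ('k, 'v, 'm1, 'e1) vmodule_scheme \<Rightarrow>
   ('k, 'v, 'm2, 'e2) vmodule_scheme \<Rightarrow> ('k, 'v, 'm3, 'e3) vmodule_scheme \<Rightarrow>
   ('m1 \<Rightarrow> 'm2) \<Rightarrow> ('m2 \<Rightarrow> 'm3) \<Rightarrow> bool"
  where "right_exact K V N' N N'' f g \<longleftrightarrow>
    vertex_module K V N' \<and> vertex_module K V N \<and> vertex_module K V N'' \<and>
    f \<in> vertex_hom K V N' N \<and> g \<in> vertex_hom K V N N'' \<and>
    f ` carrier N' = a_kernel N N'' g \<and> g ` carrier N = carrier N''"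


section \<open>Tensor products\<close>

text \<open>
  Coefficients of the two-variable series below: \<open>a_z F_x(u,v)\<close> has the coefficient
  \<open>(a_z F_q(u,v))_p\<close> at \<open>z^p x^q\<close>.
\<close>

definition vertex_bilinear ::
  "('k, 'c) ring_scheme \<Rightarrow> ('k, 'v, 'd) valgebra_scheme \<Rightarrow> ('k, 'v, 'm, 'e) vmodule_scheme \<Rightarrow>
   ('k, 'v, 'n, 'f) vmodule_scheme \<Rightarrow> ('k, 'v, 'w, 'g) vmodule_scheme \<Rightarrow>
   ('m \<Rightarrow> 'n \<Rightarrow> int \<Rightarrow> 'w) \<Rightarrow> bool"
  where "vertex_bilinear K V M N W F \<longleftrightarrow>
    laurent_bilinear K M N W F \<and>
    (\<forall>u\<in>carrier M. \<forall>v\<in>carrier N. F (transl M u) v = deriv_series W (F u v)) \<and>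
    (\<forall>u\<in>carrier M. \<forall>v\<in>carrier N.
       F u (transl N v) = (\<lambda>n. transl W (F u v n) \<ominus>\<^bsub>W\<^esub> deriv_series W (F u v) n)) \<and>
    (\<forall>a\<in>carrier V. \<forall>u\<in>carrier M. \<forall>v\<in>carrier N. \<exists>n k.
       (mult_plus W ^^ n) (vop_at_plus W a (F u v))
         = (mult_plus W ^^ n) (\<lambda>p. F (vop M a u p) v) \<and>
       (mult_minus W ^^ k) (\<lambda>p q. vop W a (F u v q) p)
         = (mult_minus W ^^ k) (\<lambda>p q. F u (vop N a v p) q))"

text \<open>
  The universal property quantifies over modules whose underlying set lies in the type \<^typ>\<open>'t\<close> of
  elements of the tensor product; that type plays the role of the universe of sets.  Homomorphisms
  are compared on the carrier, hence the restriction to extensional functions.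
\<close>

definition tensor_product ::
  "('k, 'c) ring_scheme \<Rightarrow> ('k, 'v, 'd) valgebra_scheme \<Rightarrow> ('k, 'v, 'm, 'e) vmodule_scheme \<Rightarrow>
   ('k, 'v, 'n, 'f) vmodule_scheme \<Rightarrow> ('k, 'v, 't) vmodule \<Rightarrow>
   ('m \<Rightarrow> 'n \<Rightarrow> int \<Rightarrow> 't) \<Rightarrow> bool"
  where "tensor_product K V M N T F \<longleftrightarrow>
    vertex_module K V T \<and> vertex_bilinear K V M N T F \<and>
    (\<forall>(W :: ('k, 'v, 't) vmodule) I. vertex_module K V W \<longrightarrow> vertex_bilinear K V M N W I \<longrightarrow>
       (\<exists>!\<phi>. \<phi> \<in> vertex_hom K V T W \<and> \<phi> \<in> extensional (carrier T) \<and>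
          (\<forall>u\<in>carrier M. \<forall>v\<in>carrier N. \<forall>n. I u v n = \<phi> (F u v n))))"

text \<open>
  The map \<open>1_M \<otimes> g\<close> from the tensor product \<open>(T, F)\<close> of \<open>(M, N)\<close> to the tensor product
  \<open>(T', F')\<close> of \<open>(M, N')\<close>, for a homomorphism \<open>g\<close> from \<open>N\<close> to \<open>N'\<close>.
\<close>

definition tensor_id_map ::
  "('k, 'c) ring_scheme \<Rightarrow> ('k, 'v, 'd) valgebra_scheme \<Rightarrow> ('k, 'v, 'm, 'e) vmodule_scheme \<Rightarrow>
   ('k, 'v, 'n, 'f) vmodule_scheme \<Rightarrow>
   ('k, 'v, 't) vmodule \<Rightarrow> ('m \<Rightarrow> 'n \<Rightarrow> int \<Rightarrow> 't) \<Rightarrow>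
   ('k, 'v, 's) vmodule \<Rightarrow> ('m \<Rightarrow> 'n' \<Rightarrow> int \<Rightarrow> 's) \<Rightarrow> ('n \<Rightarrow> 'n') \<Rightarrow> 't \<Rightarrow> 's"
  where "tensor_id_map K V M N T F T' F' g =
    (THE \<phi>. \<phi> \<in> vertex_hom K V T T' \<and> \<phi> \<in> extensional (carrier T) \<and>
       (\<forall>u\<in>carrier M. \<forall>v\<in>carrier N. \<forall>n. \<phi> (F u v n) = F' u (g v) n))"

end

theory Submission
  imports Defs
begin

text \<open>
  Both nontrivial inclusions come from uniqueness in the universal property, tested against cokernels.
  The projection of \<open>T''\<close> onto the cokernel of \<open>1 \<otimes> g\<close> kills every \<open>u \<otimes>_z g(v)\<close>, so it is zero.
  For the cokernel \<open>Q\<close> of \<open>1 \<otimes> f\<close>, the map \<open>(u, g(v)) \<mapsto> [u \<otimes>_z v]\<close> is well defined by exactness of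
  the given sequence, and induces \<open>\<chi> : T'' \<rightarrow> Q\<close> with \<open>\<chi> \<circ> (1 \<otimes> g)\<close> equal to the projection of \<open>T\<close>
  onto \<open>Q\<close>; hence the kernel of \<open>1 \<otimes> g\<close> lies in the image of \<open>1 \<otimes> f\<close>.
\<close>


section \<open>Linear maps and formal series\<close>

text \<open>Only \<open>K\<close>-linearity is assumed, so the same facts serve vertex
  homomorphisms, single modes of an action, translations, and a bilinear map with one argument and
  the exponent fixed.\<close>

locale linear_map = A: module K A + B: module K B
  for K :: "('k, 'c) ring_scheme" (structure)
    and A :: "('k, 'a, 'd) module_scheme" and B :: "('k, 'b, 'e) module_scheme" +
  fixes \<phi> :: "'a \<Rightarrow> 'b"
  assumes linear: "\<phi> \<in> linear_maps K A B"
begin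

lemma closed [simp]: "x \<in> carrier A \<Longrightarrow> \<phi> x \<in> carrier B"
  and add [simp]: "x \<in> carrier A \<Longrightarrow> y \<in> carrier A \<Longrightarrow> \<phi> (x \<oplus>\<^bsub>A\<^esub> y) = \<phi> x \<oplus>\<^bsub>B\<^esub> \<phi> y"
  and smult [simp]: "c \<in> carrier K \<Longrightarrow> x \<in> carrier A \<Longrightarrow> \<phi> (c \<odot>\<^bsub>A\<^esub> x) = c \<odot>\<^bsub>B\<^esub> \<phi> x"
  using linear by (auto simp: linear_maps_def Pi_iff)

sublocale hom: abelian_group_hom A B \<phi>
  by (rule abelian_group_homI)
     (auto intro!: A.abelian_group_axioms B.abelian_group_axioms A.a_group B.a_group
        simp: group_hom_def group_hom_axioms_def hom_def)

lemma minus [simp]: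
  "x \<in> carrier A \<Longrightarrow> y \<in> carrier A \<Longrightarrow> \<phi> (x \<ominus>\<^bsub>A\<^esub> y) = \<phi> x \<ominus>\<^bsub>B\<^esub> \<phi> y"
  by (simp add: a_minus_def)

lemma int_multiple [simp]: "x \<in> carrier A \<Longrightarrow> \<phi> ([(k::int)] \<cdot>\<^bsub>A\<^esub> x) = [k] \<cdot>\<^bsub>B\<^esub> \<phi> x"
  using group_hom.hom_int_pow[OF hom.a_group_hom] by (simp add: add_pow_def)

lemma finsum: "h \<in> I \<rightarrow> carrier A \<Longrightarrow> \<phi> (finsum A h I) = finsum B (\<phi> \<circ> h) I"
  by (induction I rule: infinite_finite_induct) (auto simp: Pi_iff)

text \<open>The support can only shrink under \<open>\<phi>\<close>, and the indices that drop out
  contribute zero. Finiteness matters: \<open>finsum\<close> over an infinite set is zero by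
  default, so an infinite support in \<open>A\<close> could shrink to a finite one with a different
  sum.\<close>

lemma support_sum:
  assumes "\<And>i. h i \<in> carrier A" "finite {i. h i \<noteq> \<zero>\<^bsub>A\<^esub>}"
  shows "\<phi> (support_sum A h) = support_sum B (\<lambda>i. \<phi> (h i))"
proof -
  have "finsum B (\<phi> \<circ> h) {i. h i \<noteq> \<zero>\<^bsub>A\<^esub>} = finsum B (\<lambda>i. \<phi> (h i)) {i. \<phi> (h i) \<noteq> \<zero>\<^bsub>B\<^esub>}"
    using assms by (intro B.add.finprod_mono_neutral_cong_right) auto
  then show ?thesis
    using assms by (simp add: support_sum_def finsum)
qed

lemma laurent: "f \<in> laurent A \<Longrightarrow> (\<lambda>n. \<phi> (f n)) \<in> laurent B"
  by (force simp: laurent_def)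

lemma const_series: "(\<lambda>n. \<phi> (const_series A u n)) = const_series B (\<phi> u)"
  by (auto simp: const_series_def)

lemma deriv_series:
  "(\<And>n. f n \<in> carrier A) \<Longrightarrow> \<phi> (deriv_series A f n) = deriv_series B (\<lambda>n. \<phi> (f n)) n"
  by (simp add: deriv_series_def)

lemma at_plus:
  "(\<And>n. f n \<in> carrier A) \<Longrightarrow> \<phi> (at_plus A f p q) = at_plus B (\<lambda>n. \<phi> (f n)) p q"
  by (simp add: at_plus_def)

text \<open>Closure and commutation share one induction, because \<open>\<phi>\<close> is known to
  be additive only on the carrier.\<close>

lemma mult_plus_power:
  assumes "\<And>p q. G p q \<in> carrier A"
  shows "(mult_plus A ^^ l) G p q \<in> carrier A \<and>
    \<phi> ((mult_plus A ^^ l) G p q) = (mult_plus B ^^ l) (\<lambda>p q. \<phi> (G p q)) p q"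
  by (induction l arbitrary: p q) (auto simp: assms mult_plus_def)

lemma mult_minus_power:
  assumes "\<And>p q. G p q \<in> carrier A"
  shows "(mult_minus A ^^ l) G p q \<in> carrier A \<and>
    \<phi> ((mult_minus A ^^ l) G p q) = (mult_minus B ^^ l) (\<lambda>p q. \<phi> (G p q)) p q"
  by (induction l arbitrary: p q) (auto simp: assms mult_minus_def)

text \<open>This transports identities that hold after multiplication by a power of
  \<open>z+x\<close>, such as weak associativity, and keeps the exponent.\<close>

lemma mult_plus_power_eq:
  assumes "(mult_plus A ^^ l) G = (mult_plus A ^^ l) H"
    and "\<And>p q. G p q \<in> carrier A" "\<And>p q. H p q \<in> carrier A"
  shows "(mult_plus B ^^ l) (\<lambda>p q. \<phi> (G p q)) = (mult_plus B ^^ l) (\<lambda>p q. \<phi> (H p q))"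
proof (intro ext)
  fix p q
  show "(mult_plus B ^^ l) (\<lambda>p q. \<phi> (G p q)) p q = (mult_plus B ^^ l) (\<lambda>p q. \<phi> (H p q)) p q"
    using mult_plus_power[of G l p q] mult_plus_power[of H l p q] assms by simp
qed

lemma mult_minus_power_eq:
  assumes "(mult_minus A ^^ l) G = (mult_minus A ^^ l) H"
    and "\<And>p q. G p q \<in> carrier A" "\<And>p q. H p q \<in> carrier A"
  shows "(mult_minus B ^^ l) (\<lambda>p q. \<phi> (G p q)) = (mult_minus B ^^ l) (\<lambda>p q. \<phi> (H p q))"
proof (intro ext)
  fix p q
  show "(mult_minus B ^^ l) (\<lambda>p q. \<phi> (G p q)) p q = (mult_minus B ^^ l) (\<lambda>p q. \<phi> (H p q)) p q"
    using mult_minus_power[of G l p q] mult_minus_power[of H l p q] assms by simp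
qed

end

lemma linear_map_compose:
  assumes "\<phi> \<in> linear_maps K A B" "\<psi> \<in> linear_maps K B C"
  shows "(\<lambda>x. \<psi> (\<phi> x)) \<in> linear_maps K A C"
  using assms by (auto simp: linear_maps_def Pi_iff)

lemma linear_maps_cong:
  assumes "\<And>x. x \<in> carrier A \<Longrightarrow> \<phi> x = \<psi> x" "module K A"
  shows "\<phi> \<in> linear_maps K A B \<longleftrightarrow> \<psi> \<in> linear_maps K A B"
proof -
  interpret module K A by fact
  show ?thesis using assms(1) by (auto simp: linear_maps_def Pi_iff)
qed

text \<open>Scalars commute, so scaling is itself linear and passes to quotients in the same way as
  modes and translation.\<close>

lemma (in module) smult_linear:
  assumes "c \<in> carrier R"
  shows "(\<lambda>x. c \<odot>\<^bsub>M\<^esub> x) \<in> linear_maps R M M"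
proof -
  have "c \<odot>\<^bsub>M\<^esub> (b \<odot>\<^bsub>M\<^esub> x) = b \<odot>\<^bsub>M\<^esub> (c \<odot>\<^bsub>M\<^esub> x)" if "b \<in> carrier R" "x \<in> carrier M" for b x
    using smult_assoc1[of c b x] smult_assoc1[of b c x] R.m_comm[of b c] assms that by simp
  then show ?thesis
    using assms by (simp add: linear_maps_def smult_r_distr)
qed

lemma laurent_bilinear_closed:
  "laurent_bilinear K A B W F \<Longrightarrow> a \<in> carrier A \<Longrightarrow> b \<in> carrier B \<Longrightarrow> F a b n \<in> carrier W"
  by (auto simp: laurent_bilinear_def laurent_def)

section \<open>Coefficients of the action on a vertex module\<close>

context vertex_module
begin

lemma act_closed [simp]: "a \<in> carrier V \<Longrightarrow> u \<in> carrier M \<Longrightarrow> vop M a u n \<in> carrier M"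
  by (rule laurent_bilinear_closed[OF act_laurent_bilinear])

lemma alg_closed [simp]: "a \<in> carrier V \<Longrightarrow> b \<in> carrier V \<Longrightarrow> vop V a b n \<in> carrier V"
  by (rule laurent_bilinear_closed[OF vop_laurent_bilinear])

lemma act_laurent: "a \<in> carrier V \<Longrightarrow> u \<in> carrier M \<Longrightarrow> vop M a u \<in> laurent M"
  using act_laurent_bilinear by (auto simp: laurent_bilinear_def)

lemma transl_closed [simp]: "u \<in> carrier M \<Longrightarrow> transl M u \<in> carrier M"
  using mod_transl_linear by (auto simp: linear_maps_def)

lemma act_linear: "a \<in> carrier V \<Longrightarrow> (\<lambda>u. vop M a u n) \<in> linear_maps K M M"
  using act_laurent_bilinear by (auto simp: laurent_bilinear_def)

lemma act_zero: "a \<in> carrier V \<Longrightarrow> vop M a \<zero>\<^bsub>M\<^esub> n = \<zero>\<^bsub>M\<^esub>"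
proof -
  assume "a \<in> carrier V"
  then interpret linear_map K M M "\<lambda>u. vop M a u n"
    by unfold_locales (rule act_linear)
  show ?thesis by (rule hom.hom_zero)
qed

lemma transl_zero: "transl M \<zero>\<^bsub>M\<^esub> = \<zero>\<^bsub>M\<^esub>"
proof -
  interpret linear_map K M M "transl M"
    by unfold_locales (rule mod_transl_linear)
  show ?thesis by (rule hom.hom_zero)
qed

lemma at_plus_closed: "(\<And>n. f n \<in> carrier M) \<Longrightarrow> at_plus M f p q \<in> carrier M"
  unfolding at_plus_def by (auto simp: add_pow_def M.a_group intro: group.int_pow_closed[OF M.a_group, simplified])

text \<open>Indices below the order of \<open>F\<close> give zero since \<open>F m\<close> vanishes
  there. Indices above \<open>q\<close> give zero since the expansion of \<open>z+x\<close> has no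
  negative powers of \<open>x\<close>. Only an interval remains.\<close>

lemma finite_support_vop_at_plus:
  assumes "a \<in> carrier V" "F \<in> laurent M"
  shows "finite {m. at_plus M (vop M a (F m)) p (q - m) \<noteq> \<zero>\<^bsub>M\<^esub>}"
proof -
  obtain N where N: "\<And>n. n < N \<Longrightarrow> F n = \<zero>\<^bsub>M\<^esub>"
    using assms(2) by (auto simp: laurent_def)
  have "at_plus M (vop M a (F m)) p (q - m) = \<zero>\<^bsub>M\<^esub>" if "m \<notin> {N..q}" for m
  proof (cases "m < N")
    case True
    then show ?thesis
      using assms group.int_pow_one[OF M.a_group, simplified]
      by (simp add: N at_plus_def act_zero add_pow_def)
  next
    case False
    then show ?thesis using that by (simp add: at_plus_def)
  qed
  then have "{m. at_plus M (vop M a (F m)) p (q - m) \<noteq> \<zero>\<^bsub>M\<^esub>} \<subseteq> {N..q}"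
    by blast
  then show ?thesis
    by (rule finite_subset) simp
qed

lemma vop_at_plus_closed:
  assumes "a \<in> carrier V" "F \<in> laurent M"
  shows "vop_at_plus M a F p q \<in> carrier M"
  using assms unfolding vop_at_plus_def support_sum_def
  by (intro M.finsum_closed) (auto intro!: at_plus_closed simp: laurent_def)

text \<open>
  Only the module structure of the target is required, so that this applies before the target is
  known to be a vertex module.
\<close>

lemma vop_at_plus_image:
  assumes "linear_map K M W \<phi>"
    and vop: "\<And>u n. u \<in> carrier M \<Longrightarrow> \<phi> (vop M a u n) = vop W a (\<phi> u) n"
    and a: "a \<in> carrier V" and F: "F \<in> laurent M"
  shows "\<phi> (vop_at_plus M a F p q) = vop_at_plus W a (\<lambda>n. \<phi> (F n)) p q"
proof -
  interpret linear_map K M W \<phi> by fact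
  have F': "F m \<in> carrier M" for m using F by (simp add: laurent_def)
  show ?thesis
    unfolding vop_at_plus_def
    by (subst support_sum)
       (simp_all add: a F F' finite_support_vop_at_plus at_plus_closed at_plus vop)
qed

end


section \<open>Images and cokernels\<close>

text \<open>Every element of \<open>B\<close> is an image, so each axiom is inherited from
  \<open>A\<close>. As \<open>B\<close> is not yet known to be a group, the value at zero cannot be
  deduced from additivity and is assumed.\<close>

lemma module_image:
  fixes A :: "('k, 'a, 'd) module_scheme" and B :: "('k, 'b, 'e) module_scheme"
  assumes "module K A" and surj: "\<phi> ` carrier A = carrier B"
    and add: "\<And>x y. x \<in> carrier A \<Longrightarrow> y \<in> carrier A \<Longrightarrow> \<phi> (x \<oplus>\<^bsub>A\<^esub> y) = \<phi> x \<oplus>\<^bsub>B\<^esub> \<phi> y"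
    and smult: "\<And>c x. c \<in> carrier K \<Longrightarrow> x \<in> carrier A \<Longrightarrow> \<phi> (c \<odot>\<^bsub>A\<^esub> x) = c \<odot>\<^bsub>B\<^esub> \<phi> x"
    and zero: "\<phi> \<zero>\<^bsub>A\<^esub> = \<zero>\<^bsub>B\<^esub>"
  shows "module K B"
proof -
  interpret A: module K A by fact
  have img: "\<phi> x \<in> carrier B" if "x \<in> carrier A" for x
    using surj that by blast
  have ex: "\<exists>x'. y = \<phi> x' \<and> x' \<in> carrier A" if "y \<in> carrier B" for y
    using surj that by blast
  \<comment> \<open>Read from right to left, these rules collapse an expression over
    \<open>B\<close> into \<open>\<phi>\<close> of the same expression over
    \<open>A\<close>.\<close>
  note [simp] = add[symmetric] smult[symmetric] zero[symmetric] img
  have "abelian_group B"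
  proof (rule abelian_groupI)
    fix x y z assume xyz: "x \<in> carrier B" "y \<in> carrier B" "z \<in> carrier B"
    obtain x' y' z' where
      "x = \<phi> x'" "y = \<phi> y'" "z = \<phi> z'" "x' \<in> carrier A" "y' \<in> carrier A" "z' \<in> carrier A"
      using ex[OF xyz(1)] ex[OF xyz(2)] ex[OF xyz(3)] by metis
    then show "x \<oplus>\<^bsub>B\<^esub> y \<in> carrier B" "(x \<oplus>\<^bsub>B\<^esub> y) \<oplus>\<^bsub>B\<^esub> z = x \<oplus>\<^bsub>B\<^esub> (y \<oplus>\<^bsub>B\<^esub> z)"
      "x \<oplus>\<^bsub>B\<^esub> y = y \<oplus>\<^bsub>B\<^esub> x" "\<zero>\<^bsub>B\<^esub> \<oplus>\<^bsub>B\<^esub> x = x"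
      by (simp_all add: A.a_ac)
  next
    fix x assume "x \<in> carrier B"
    then obtain x' where "x = \<phi> x'" "x' \<in> carrier A"
      using surj by blast
    then show "\<exists>y\<in>carrier B. y \<oplus>\<^bsub>B\<^esub> x = \<zero>\<^bsub>B\<^esub>"
      by (intro bexI[of _ "\<phi> (\<ominus>\<^bsub>A\<^esub> x')"]) (simp_all add: A.l_neg)
  qed (simp add: surj)
  then show ?thesis
  proof (rule moduleI[OF A.R.is_cring])
    fix a b x y assume ab: "a \<in> carrier K" "b \<in> carrier K" and xy: "x \<in> carrier B" "y \<in> carrier B"
    obtain x' y' where "x = \<phi> x'" "y = \<phi> y'" "x' \<in> carrier A" "y' \<in> carrier A"
      using ex[OF xy(1)] ex[OF xy(2)] by metis
    with ab show "a \<odot>\<^bsub>B\<^esub> x \<in> carrier B" "(a \<oplus>\<^bsub>K\<^esub> b) \<odot>\<^bsub>B\<^esub> x = a \<odot>\<^bsub>B\<^esub> x \<oplus>\<^bsub>B\<^esub> b \<odot>\<^bsub>B\<^esub> x"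
      "a \<odot>\<^bsub>B\<^esub> (x \<oplus>\<^bsub>B\<^esub> y) = a \<odot>\<^bsub>B\<^esub> x \<oplus>\<^bsub>B\<^esub> a \<odot>\<^bsub>B\<^esub> y"
      "(a \<otimes>\<^bsub>K\<^esub> b) \<odot>\<^bsub>B\<^esub> x = a \<odot>\<^bsub>B\<^esub> (b \<odot>\<^bsub>B\<^esub> x)"
      by (simp_all add: A.smult_l_distr A.smult_r_distr A.smult_assoc1)
  next
    fix x assume "x \<in> carrier B"
    then obtain x' where "x = \<phi> x'" "x' \<in> carrier A"
      using ex by blast
    then show "\<one>\<^bsub>K\<^esub> \<odot>\<^bsub>B\<^esub> x = x"
      by simp
  qed
qed

text \<open>Each axiom is an equation between coefficients, possibly after multiplication by a power
  of \<open>z+x\<close>, and survives a linear map that commutes with all operations. This makes a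
  quotient a vertex module without checking its axioms on cosets.\<close>

lemma vertex_module_image:
  assumes M: "vertex_module K V M" and surj: "\<phi> ` carrier M = carrier W"
    and add: "\<And>x y. x \<in> carrier M \<Longrightarrow> y \<in> carrier M \<Longrightarrow> \<phi> (x \<oplus>\<^bsub>M\<^esub> y) = \<phi> x \<oplus>\<^bsub>W\<^esub> \<phi> y"
    and smult: "\<And>c x. c \<in> carrier K \<Longrightarrow> x \<in> carrier M \<Longrightarrow> \<phi> (c \<odot>\<^bsub>M\<^esub> x) = c \<odot>\<^bsub>W\<^esub> \<phi> x"
    and zero: "\<phi> \<zero>\<^bsub>M\<^esub> = \<zero>\<^bsub>W\<^esub>"
    and vop: "\<And>a u n. a \<in> carrier V \<Longrightarrow> u \<in> carrier M \<Longrightarrow> \<phi> (vop M a u n) = vop W a (\<phi> u) n"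
    and transl: "\<And>u. u \<in> carrier M \<Longrightarrow> \<phi> (transl M u) = transl W (\<phi> u)"
  shows "vertex_module K V W" and "\<phi> \<in> vertex_hom K V M W"
proof -
  interpret M: vertex_module K V M by fact
  interpret W: module K W
    using M.M.module_axioms surj add smult zero by (rule module_image)
  have lin: "\<phi> \<in> linear_maps K M W"
    using surj add smult by (auto simp: linear_maps_def)
  then show "\<phi> \<in> vertex_hom K V M W"
    by (simp add: vertex_hom_def vop transl)
  interpret \<phi>: linear_map K M W \<phi>
    by unfold_locales fact
  have vop': "vop W a (\<phi> u) = (\<lambda>n. \<phi> (vop M a u n))" if "a \<in> carrier V" "u \<in> carrier M" for a u
    using vop that by auto
  show "vertex_module K V W"
  proof unfold_locales
    have "vop W a w \<in> laurent W" if a: "a \<in> carrier V" and w: "w \<in> carrier W" for a w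
    proof -
      obtain u where "w = \<phi> u" "u \<in> carrier M" using surj w by blast
      then show ?thesis using a by (simp add: vop' \<phi>.laurent M.act_laurent)
    qed
    moreover have "(\<lambda>a. vop W a w n) \<in> linear_maps K V W" if w: "w \<in> carrier W" for w n
    proof -
      obtain u where u: "w = \<phi> u" "u \<in> carrier M" using surj w by blast
      have "(\<lambda>a. vop M a u n) \<in> linear_maps K V M"
        using u M.act_laurent_bilinear by (auto simp: laurent_bilinear_def)
      then have "(\<lambda>a. \<phi> (vop M a u n)) \<in> linear_maps K V W"
        using lin by (rule linear_map_compose)
      \<comment> \<open>The two functions of \<open>a\<close> agree only on the carrier of
        \<open>V\<close>, hence the congruence rule instead of plain rewriting.\<close>
      then show ?thesis
        using u by (subst linear_maps_cong[OF _ M.module_axioms]) (auto simp: vop)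
    qed
    moreover have "(\<lambda>w. vop W a w n) \<in> linear_maps K W W" if a: "a \<in> carrier V" for a n
    proof -
      interpret a: linear_map K M M "\<lambda>u. vop M a u n"
        by unfold_locales (rule M.act_linear[OF a])
      have "vop W a (x \<oplus>\<^bsub>W\<^esub> y) n = vop W a x n \<oplus>\<^bsub>W\<^esub> vop W a y n"
        if xy: "x \<in> carrier W" "y \<in> carrier W" for x y
      proof -
        obtain x' y' where x': "x = \<phi> x'" "x' \<in> carrier M" and y': "y = \<phi> y'" "y' \<in> carrier M"
          using surj xy by blast
        then show ?thesis
          using vop[OF a, of "x' \<oplus>\<^bsub>M\<^esub> y'" n] a by (simp add: vop)
      qed
      moreover have "vop W a (c \<odot>\<^bsub>W\<^esub> x) n = c \<odot>\<^bsub>W\<^esub> vop W a x n"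
        if cx: "c \<in> carrier K" "x \<in> carrier W" for c x
      proof -
        obtain x' where x': "x = \<phi> x'" "x' \<in> carrier M"
          using surj cx by blast
        then show ?thesis
          using vop[OF a, of "c \<odot>\<^bsub>M\<^esub> x'" n] cx a by (simp add: vop)
      qed
      moreover have "vop W a x n \<in> carrier W" if x: "x \<in> carrier W" for x
      proof -
        obtain x' where "x = \<phi> x'" "x' \<in> carrier M"
          using surj x by blast
        then show ?thesis using a by (simp add: vop')
      qed
      ultimately show ?thesis by (simp add: linear_maps_def)
    qed
    ultimately show "laurent_bilinear K V W W (vop W)"
      by (simp add: laurent_bilinear_def)
  next
    interpret d: linear_map K M M "transl M"
      by unfold_locales (rule M.mod_transl_linear)
    have "transl W (x \<oplus>\<^bsub>W\<^esub> y) = transl W x \<oplus>\<^bsub>W\<^esub> transl W y"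
      if xy: "x \<in> carrier W" "y \<in> carrier W" for x y
    proof -
      obtain x' y' where x': "x = \<phi> x'" "x' \<in> carrier M" and y': "y = \<phi> y'" "y' \<in> carrier M"
        using surj xy by blast
      then show ?thesis
        using transl[of "x' \<oplus>\<^bsub>M\<^esub> y'"] by (simp add: transl)
    qed
    moreover have "transl W (c \<odot>\<^bsub>W\<^esub> x) = c \<odot>\<^bsub>W\<^esub> transl W x"
      if cx: "c \<in> carrier K" "x \<in> carrier W" for c x
    proof -
      obtain x' where x': "x = \<phi> x'" "x' \<in> carrier M"
        using surj cx by blast
      then show ?thesis
        using transl[of "c \<odot>\<^bsub>M\<^esub> x'"] cx by (simp add: transl)
    qed
    moreover have "transl W x \<in> carrier W" if x: "x \<in> carrier W" for x
    proof -
      obtain x' where "x = \<phi> x'" "x' \<in> carrier M"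
        using surj x by blast
      then show ?thesis by (simp add: transl[symmetric])
    qed
    ultimately show "transl W \<in> linear_maps K W W"
      by (simp add: linear_maps_def)
  next
    fix w assume "w \<in> carrier W"
    then obtain u where u: "w = \<phi> u" "u \<in> carrier M" using surj by blast
    then show "vop W (vac V) w = const_series W w"
      by (simp add: vop' M.vac_closed M.act_vac \<phi>.const_series)
  next
    fix a w assume a: "a \<in> carrier V" and "w \<in> carrier W"
    then obtain u where u: "w = \<phi> u" "u \<in> carrier M" using surj by blast
    have d: "transl V a \<in> carrier V"
      using a M.transl_linear by (auto simp: linear_maps_def)
    show "vop W (transl V a) w = deriv_series W (vop W a w)"
      using a u d by (simp add: vop' M.act_transl \<phi>.deriv_series)
    show "transl W (vop W a w n) = vop W (transl V a) w n \<oplus>\<^bsub>W\<^esub> vop W a (transl W w) n" for n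
      using a u d by (simp add: vop[symmetric] transl[symmetric] M.transl_act)
  next
    fix a b w assume ab: "a \<in> carrier V" "b \<in> carrier V" and "w \<in> carrier W"
    then obtain u where u: "w = \<phi> u" "u \<in> carrier M" using surj by blast
    \<comment> \<open>The exponent that works for a preimage \<open>u\<close> also works for
      \<open>w\<close>.\<close>
    obtain l where l: "(mult_plus M ^^ l) (\<lambda>p. vop M (vop V a b p) u)
        = (mult_plus M ^^ l) (vop_at_plus M a (vop M b u))"
      using M.act_assoc ab u by blast
    have "(mult_plus W ^^ l) (\<lambda>p q. \<phi> (vop M (vop V a b p) u q))
        = (mult_plus W ^^ l) (\<lambda>p q. \<phi> (vop_at_plus M a (vop M b u) p q))"
      using ab u by (intro \<phi>.mult_plus_power_eq[OF l]) (simp_all add: M.vop_at_plus_closed M.act_laurent)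
    moreover have "\<phi> (vop_at_plus M a (vop M b u) p q) = vop_at_plus W a (vop W b w) p q" for p q
      using ab u by (simp add: vop' M.vop_at_plus_image[OF \<phi>.linear_map_axioms] M.act_laurent)
    ultimately show "\<exists>l. (mult_plus W ^^ l) (\<lambda>p. vop W (vop V a b p) w)
        = (mult_plus W ^^ l) (vop_at_plus W a (vop W b w))"
      using ab u by (intro exI[of _ l]) (simp add: vop')
  qed
qed

section \<open>Homomorphisms of vertex modules\<close>

lemma linear_map_vertex_hom:
  assumes "vertex_module K V M" "vertex_module K V N" "\<phi> \<in> vertex_hom K V M N"
  shows "linear_map K M N \<phi>"
proof -
  interpret M: vertex_module K V M by fact
  interpret N: vertex_module K V N by fact
  show ?thesis
    using assms(3) by unfold_locales (simp add: vertex_hom_def)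
qed

lemma vertex_hom_compose:
  assumes "\<phi> \<in> vertex_hom K V L M" "\<psi> \<in> vertex_hom K V M N"
  shows "(\<lambda>x. \<psi> (\<phi> x)) \<in> vertex_hom K V L N"
  using assms by (auto simp: vertex_hom_def linear_maps_def Pi_iff)

text \<open>The zero map is what other homomorphisms are compared with when uniqueness is used to
  show that they vanish.\<close>

lemma vertex_hom_zero:
  assumes "vertex_module K V N"
  shows "(\<lambda>x. \<zero>\<^bsub>N\<^esub>) \<in> vertex_hom K V M N"
proof -
  interpret N: vertex_module K V N by fact
  show ?thesis
    by (auto simp: vertex_hom_def linear_maps_def N.act_zero N.transl_zero)
qed

text \<open>Uniqueness in the universal property concerns extensional functions, so homomorphisms
  have to be cut down to the carrier first.\<close>

lemma vertex_hom_restrict: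
  assumes "vertex_module K V M" "\<phi> \<in> vertex_hom K V M N"
  shows "restrict \<phi> (carrier M) \<in> vertex_hom K V M N"
proof -
  interpret M: vertex_module K V M by fact
  show ?thesis
    using assms(2) by (auto simp: vertex_hom_def linear_maps_def)
qed

text \<open>
  The quotient of \<open>W\<close> by the image of a homomorphism, realised on a set of representatives of the
  cosets so that it lives in the same type as \<open>W\<close>.
\<close>

lemma vertex_cokernel:
  fixes W :: "('k, 'v, 'w) vmodule"
  assumes U: "vertex_module K V U" and W: "vertex_module K V W" and \<phi>: "\<phi> \<in> vertex_hom K V U W"
  obtains Q :: "('k, 'v, 'w) vmodule" and \<pi> where "vertex_module K V Q" "\<pi> \<in> vertex_hom K V W Q"
    "\<And>x. x \<in> carrier W \<Longrightarrow> \<pi> x = \<zero>\<^bsub>Q\<^esub> \<longleftrightarrow> x \<in> \<phi> ` carrier U"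
proof -
  interpret U: vertex_module K V U by fact
  interpret W: vertex_module K V W by fact
  interpret \<phi>: linear_map K U W \<phi> by (rule linear_map_vertex_hom) fact+
  define S where "S = \<phi> ` carrier U"
  have SW: "x \<in> carrier W" if "x \<in> S" for x
    using that by (auto simp: S_def)
  have S_minus: "x \<ominus>\<^bsub>W\<^esub> y \<in> S" if "x \<in> S" "y \<in> S" for x y
    using that by (auto simp: S_def simp flip: \<phi>.minus)
  have S_add: "x \<oplus>\<^bsub>W\<^esub> y \<in> S" if "x \<in> S" "y \<in> S" for x y
    using that by (auto simp: S_def simp flip: \<phi>.add)
  have S_zero: "\<zero>\<^bsub>W\<^esub> \<in> S"
    unfolding S_def using \<phi>.hom.hom_zero by (metis U.M.zero_closed imageI)
  have S_smult: "c \<odot>\<^bsub>W\<^esub> x \<in> S" if "c \<in> carrier K" "x \<in> S" for c x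
    using that by (auto simp: S_def simp flip: \<phi>.smult)
  have \<phi>_vop: "\<phi> (vop U a x n) = vop W a (\<phi> x) n" if "a \<in> carrier V" "x \<in> carrier U" for a x n
    using that \<phi> by (simp add: vertex_hom_def)
  have \<phi>_transl: "\<phi> (transl U x) = transl W (\<phi> x)" if "x \<in> carrier U" for x
    using that \<phi> by (simp add: vertex_hom_def)
  have S_vop: "vop W a x n \<in> S" if "a \<in> carrier V" "x \<in> S" for a x n
    using that by (auto simp: S_def simp flip: \<phi>_vop)
  have S_transl: "transl W x \<in> S" if "x \<in> S" for x
    using that by (auto simp: S_def simp flip: \<phi>_transl)

  \<comment> \<open>\<open>r x\<close> is a chosen representative of the coset of \<open>x\<close>
    modulo \<open>S\<close>. It lies in \<open>W\<close> itself, so no type of cosets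
    arises.\<close>
  define r where "r x = (SOME y. y \<in> carrier W \<and> y \<ominus>\<^bsub>W\<^esub> x \<in> S)" for x
  have r: "r x \<in> carrier W" "r x \<ominus>\<^bsub>W\<^esub> x \<in> S" if "x \<in> carrier W" for x
  proof -
    have "x \<in> carrier W \<and> x \<ominus>\<^bsub>W\<^esub> x \<in> S"
      using that S_zero by (simp add: W.M.r_neg a_minus_def)
    then have "r x \<in> carrier W \<and> r x \<ominus>\<^bsub>W\<^esub> x \<in> S"
      unfolding r_def by (rule someI)
    then show "r x \<in> carrier W" "r x \<ominus>\<^bsub>W\<^esub> x \<in> S" by auto
  qed
  have S_trans: "x \<ominus>\<^bsub>W\<^esub> z \<in> S"
    if "x \<ominus>\<^bsub>W\<^esub> y \<in> S" "y \<ominus>\<^bsub>W\<^esub> z \<in> S" "x \<in> carrier W" "y \<in> carrier W" "z \<in> carrier W" for x y z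
  proof -
    have "x \<ominus>\<^bsub>W\<^esub> z = (x \<ominus>\<^bsub>W\<^esub> y) \<oplus>\<^bsub>W\<^esub> (y \<ominus>\<^bsub>W\<^esub> z)"
      using that(3-5) by (simp add: a_minus_def W.M.a_assoc W.M.r_neg1)
    then show ?thesis using S_add that by simp
  qed
  have S_sym: "y \<ominus>\<^bsub>W\<^esub> x \<in> S" if "x \<ominus>\<^bsub>W\<^esub> y \<in> S" "x \<in> carrier W" "y \<in> carrier W" for x y
  proof -
    have "y \<ominus>\<^bsub>W\<^esub> x = \<zero>\<^bsub>W\<^esub> \<ominus>\<^bsub>W\<^esub> (x \<ominus>\<^bsub>W\<^esub> y)"
      using that by (simp add: a_minus_def W.M.minus_add W.M.a_comm)
    then show ?thesis using S_minus S_zero that by simp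
  qed
  have r_eq_iff: "r x = r y \<longleftrightarrow> x \<ominus>\<^bsub>W\<^esub> y \<in> S" if x: "x \<in> carrier W" and y: "y \<in> carrier W" for x y
  proof
    assume "r x = r y"
    then show "x \<ominus>\<^bsub>W\<^esub> y \<in> S"
      using S_trans[OF S_sym[OF r(2)[OF x]] r(2)[OF y, folded \<open>r x = r y\<close>]] r(1) x y by simp
  next
    assume xy: "x \<ominus>\<^bsub>W\<^esub> y \<in> S"
    \<comment> \<open>Congruent \<open>x\<close> and \<open>y\<close> define the same predicate, so
      the choice operator returns the same element for both.\<close>
    have "z \<in> carrier W \<and> z \<ominus>\<^bsub>W\<^esub> x \<in> S \<longleftrightarrow> z \<in> carrier W \<and> z \<ominus>\<^bsub>W\<^esub> y \<in> S" for z
      using S_trans[OF _ xy _ x y] S_trans[OF _ S_sym[OF xy x y] _ y x] by blast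
    then show "r x = r y" by (simp add: r_def)
  qed
  \<comment> \<open>A linear \<open>h\<close> preserving \<open>S\<close> respects cosets, since
    \<open>h (r x) \<ominus> h x\<close> is the image under \<open>h\<close> of an element of
    \<open>S\<close>. This covers scalars, modes and translation alike.\<close>
  have r_descend: "r (h (r x)) = r (h x)"
    if h: "h \<in> linear_maps K W W" and hS: "\<And>x. x \<in> S \<Longrightarrow> h x \<in> S" and x: "x \<in> carrier W" for h x
  proof -
    interpret h: linear_map K W W h by unfold_locales fact
    have "h (r x) \<ominus>\<^bsub>W\<^esub> h x \<in> S"
      using hS[OF r(2)[OF x]] x r(1) by simp
    then show ?thesis
      using r_eq_iff x r(1) by simp
  qed
  have r_add: "r (r x \<oplus>\<^bsub>W\<^esub> r y) = r (x \<oplus>\<^bsub>W\<^esub> y)" if x: "x \<in> carrier W" and y: "y \<in> carrier W" for x y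
  proof -
    have "(r x \<oplus>\<^bsub>W\<^esub> r y) \<ominus>\<^bsub>W\<^esub> (x \<oplus>\<^bsub>W\<^esub> y) = (r x \<ominus>\<^bsub>W\<^esub> x) \<oplus>\<^bsub>W\<^esub> (r y \<ominus>\<^bsub>W\<^esub> y)"
      using x y r(1) by (simp add: a_minus_def W.M.minus_add W.M.a_ac)
    then show ?thesis
      using r_eq_iff S_add r x y by simp
  qed

  \<comment> \<open>Each operation is performed in \<open>W\<close> and then normalised by
    \<open>r\<close>. The zero is \<open>r\<close> of the old zero, because the representative
    chosen for \<open>S\<close> may be another element of \<open>S\<close>.\<close>
  define Q where "Q = W\<lparr>carrier := r ` carrier W, zero := r \<zero>\<^bsub>W\<^esub>,
    add := \<lambda>x y. r (x \<oplus>\<^bsub>W\<^esub> y), smult := \<lambda>c x. r (c \<odot>\<^bsub>W\<^esub> x),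
    transl := \<lambda>x. r (transl W x), vop := \<lambda>a x n. r (vop W a x n)\<rparr>"
  have "r ` carrier W = carrier Q" by (simp add: Q_def)
  moreover have "r (x \<oplus>\<^bsub>W\<^esub> y) = r x \<oplus>\<^bsub>Q\<^esub> r y" if "x \<in> carrier W" "y \<in> carrier W" for x y
    using that by (simp add: Q_def r_add)
  moreover have "r (c \<odot>\<^bsub>W\<^esub> x) = c \<odot>\<^bsub>Q\<^esub> r x" if "c \<in> carrier K" "x \<in> carrier W" for c x
    using that r_descend[OF W.M.smult_linear S_smult] by (simp add: Q_def)
  moreover have "r \<zero>\<^bsub>W\<^esub> = \<zero>\<^bsub>Q\<^esub>" by (simp add: Q_def)
  moreover have "r (vop W a x n) = vop Q a (r x) n" if "a \<in> carrier V" "x \<in> carrier W" for a x n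
    using that r_descend[OF W.act_linear S_vop] by (simp add: Q_def)
  moreover have "r (transl W x) = transl Q (r x)" if "x \<in> carrier W" for x
    using that r_descend[OF W.mod_transl_linear S_transl] by (simp add: Q_def)
  ultimately have "vertex_module K V Q \<and> r \<in> vertex_hom K V W Q"
    by (intro conjI; rule vertex_module_image[OF W])
  moreover have "r x = \<zero>\<^bsub>Q\<^esub> \<longleftrightarrow> x \<in> \<phi> ` carrier U" if "x \<in> carrier W" for x
  proof -
    \<comment> \<open>The zero coset is \<open>S\<close>: \<open>r x\<close> equals \<open>r\<close>
      of zero exactly when \<open>x\<close> minus zero lies in \<open>S\<close>.\<close>
    have neg_zero: "\<ominus>\<^bsub>W\<^esub> \<zero>\<^bsub>W\<^esub> = \<zero>\<^bsub>W\<^esub>"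
      using W.M.r_neg[of "\<zero>\<^bsub>W\<^esub>"] by simp
    show ?thesis
      using that r_eq_iff[of x "\<zero>\<^bsub>W\<^esub>"] by (simp add: Q_def S_def a_minus_def neg_zero)
  qed
  ultimately show thesis using that by blast
qed


section \<open>Vertex bilinear maps and tensor products\<close>

lemma vertex_bilinear_closed:
  "vertex_bilinear K V M N W F \<Longrightarrow> u \<in> carrier M \<Longrightarrow> v \<in> carrier N \<Longrightarrow> F u v n \<in> carrier W"
  unfolding vertex_bilinear_def by (blast intro: laurent_bilinear_closed)

text \<open>A homomorphism commutes with modes and translation, so it carries each identity over
  coefficient by coefficient, with the same exponents \<open>n\<close> and \<open>k\<close>.\<close>

lemma vertex_bilinear_compose:
  assumes M: "vertex_module K V M" and N: "vertex_module K V N"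
    and W: "vertex_module K V W" and W': "vertex_module K V W'"
    and F: "vertex_bilinear K V M N W F" and \<phi>: "\<phi> \<in> vertex_hom K V W W'"
  shows "vertex_bilinear K V M N W' (\<lambda>u v n. \<phi> (F u v n))"
proof -
  interpret M: vertex_module K V M by fact
  interpret N: vertex_module K V N by fact
  interpret W: vertex_module K V W by fact
  interpret \<phi>: linear_map K W W' \<phi> by (rule linear_map_vertex_hom) fact+
  have lin: "\<phi> \<in> linear_maps K W W'" by (rule \<phi>.linear)
  have vop: "\<phi> (vop W a w n) = vop W' a (\<phi> w) n" if "a \<in> carrier V" "w \<in> carrier W" for a w n
    using \<phi> that by (simp add: vertex_hom_def)
  have transl: "\<phi> (transl W w) = transl W' (\<phi> w)" if "w \<in> carrier W" for w
    using \<phi> that by (simp add: vertex_hom_def)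
  have F_closed [simp]: "F u v n \<in> carrier W" if "u \<in> carrier M" "v \<in> carrier N" for u v n
    using vertex_bilinear_closed[OF F] that .
  have F_laurent: "F u v \<in> laurent W" if "u \<in> carrier M" "v \<in> carrier N" for u v
    using F that by (simp add: vertex_bilinear_def laurent_bilinear_def)
  have "laurent_bilinear K M N W' (\<lambda>u v n. \<phi> (F u v n))"
    using F by (auto simp: vertex_bilinear_def laurent_bilinear_def
        intro: \<phi>.laurent linear_map_compose[OF _ lin])
  moreover have "(\<lambda>n. \<phi> (F (transl M u) v n)) = deriv_series W' (\<lambda>n. \<phi> (F u v n))"
    if "u \<in> carrier M" "v \<in> carrier N" for u v
    using F that by (auto simp: vertex_bilinear_def \<phi>.deriv_series)
  moreover have "(\<lambda>n. \<phi> (F u (transl N v) n)) =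
      (\<lambda>n. transl W' (\<phi> (F u v n)) \<ominus>\<^bsub>W'\<^esub> deriv_series W' (\<lambda>n. \<phi> (F u v n)) n)"
    if uv: "u \<in> carrier M" "v \<in> carrier N" for u v
  proof -
    \<comment> \<open>\<open>\<phi>\<close> splits a difference only when both terms are in the
      carrier, so the derivative is checked first.\<close>
    have "deriv_series W (F u v) n \<in> carrier W" for n
      using uv group.int_pow_closed[OF W.M.a_group]
      by (simp add: deriv_series_def add_pow_def)
    then show ?thesis
      using F uv by (simp add: vertex_bilinear_def \<phi>.deriv_series transl)
  qed
  moreover have "\<exists>n k.
      (mult_plus W' ^^ n) (vop_at_plus W' a (\<lambda>n. \<phi> (F u v n)))
        = (mult_plus W' ^^ n) (\<lambda>p n. \<phi> (F (vop M a u p) v n)) \<and>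
      (mult_minus W' ^^ k) (\<lambda>p q. vop W' a (\<phi> (F u v q)) p)
        = (mult_minus W' ^^ k) (\<lambda>p q. \<phi> (F u (vop N a v p) q))"
    if auv: "a \<in> carrier V" "u \<in> carrier M" "v \<in> carrier N" for a u v
  proof -
    obtain n k where n: "(mult_plus W ^^ n) (vop_at_plus W a (F u v))
        = (mult_plus W ^^ n) (\<lambda>p. F (vop M a u p) v)"
      and k: "(mult_minus W ^^ k) (\<lambda>p q. vop W a (F u v q) p)
        = (mult_minus W ^^ k) (\<lambda>p q. F u (vop N a v p) q)"
      using F auv unfolding vertex_bilinear_def by blast
    have "vop_at_plus W' a (\<lambda>n. \<phi> (F u v n)) = (\<lambda>p q. \<phi> (vop_at_plus W a (F u v) p q))"
      using W.vop_at_plus_image[OF \<phi>.linear_map_axioms vop] auv F_laurent by (intro ext) simp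
    with \<phi>.mult_plus_power_eq[OF n] \<phi>.mult_minus_power_eq[OF k] auv show ?thesis
      by (intro exI[of _ n] exI[of _ k]) (simp add: W.vop_at_plus_closed F_laurent vop)
  qed
  ultimately show ?thesis
    by (simp add: vertex_bilinear_def)
qed

lemma vertex_bilinear_precompose:
  assumes N: "vertex_module K V N" and F: "vertex_bilinear K V M N' W F"
    and g: "g \<in> vertex_hom K V N N'"
  shows "vertex_bilinear K V M N W (\<lambda>u v. F u (g v))"
proof -
  interpret N: vertex_module K V N by fact
  have lin: "g \<in> linear_maps K N N'" and g_closed: "\<And>v. v \<in> carrier N \<Longrightarrow> g v \<in> carrier N'"
    and g_vop: "\<And>a v n. a \<in> carrier V \<Longrightarrow> v \<in> carrier N \<Longrightarrow> g (vop N a v n) = vop N' a (g v) n"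
    and g_transl: "\<And>v. v \<in> carrier N \<Longrightarrow> g (transl N v) = transl N' (g v)"
    using g by (auto simp: vertex_hom_def linear_maps_def)
  have "(\<lambda>v. F u (g v) n) \<in> linear_maps K N W" if "u \<in> carrier M" for u n
    using that F linear_map_compose[OF lin, of "\<lambda>v. F u v n" W]
    by (simp add: vertex_bilinear_def laurent_bilinear_def)
  then have "laurent_bilinear K M N W (\<lambda>u v. F u (g v))"
    using F g_closed
    by (auto simp: vertex_bilinear_def laurent_bilinear_def)
  then show ?thesis
    using F by (simp add: vertex_bilinear_def g_closed g_vop g_transl)
qed

text \<open>Elements of \<open>N'\<close> are replaced by preimages in \<open>N\<close>, where the
  axioms are those of \<open>J\<close>. Since \<open>IJ\<close> holds for every preimage, it
  contains the independence of the choice.\<close>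

lemma vertex_bilinear_descend:
  assumes M: "vertex_module K V M" and N: "vertex_module K V N" and g: "g \<in> vertex_hom K V N N'"
    and surj: "g ` carrier N = carrier N'"
    and J: "vertex_bilinear K V M N W J"
    and IJ: "\<And>u v n. u \<in> carrier M \<Longrightarrow> v \<in> carrier N \<Longrightarrow> I u (g v) n = J u v n"
  shows "vertex_bilinear K V M N' W I"
proof -
  interpret M: vertex_module K V M by fact
  interpret N: vertex_module K V N by fact
  have g_add: "\<And>v w. v \<in> carrier N \<Longrightarrow> w \<in> carrier N \<Longrightarrow> g v \<oplus>\<^bsub>N'\<^esub> g w = g (v \<oplus>\<^bsub>N\<^esub> w)"
    and g_smult: "\<And>c v. c \<in> carrier K \<Longrightarrow> v \<in> carrier N \<Longrightarrow> c \<odot>\<^bsub>N'\<^esub> g v = g (c \<odot>\<^bsub>N\<^esub> v)"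
    and g_vop: "\<And>a v n. a \<in> carrier V \<Longrightarrow> v \<in> carrier N \<Longrightarrow> vop N' a (g v) n = g (vop N a v n)"
    and g_transl: "\<And>v. v \<in> carrier N \<Longrightarrow> transl N' (g v) = g (transl N v)"
    using g by (simp_all add: vertex_hom_def linear_maps_def)
  have IJ': "I u (g v) = J u v" if "u \<in> carrier M" "v \<in> carrier N" for u v
    using IJ that by blast
  have "I u (g v) \<in> laurent W" if "u \<in> carrier M" "v \<in> carrier N" for u v
    using J that by (simp add: vertex_bilinear_def laurent_bilinear_def IJ')
  moreover have "(\<lambda>u. I u (g v) n) \<in> linear_maps K M W" if v: "v \<in> carrier N" for v n
  proof -
    have "(\<lambda>u. J u v n) \<in> linear_maps K M W"
      using J v by (simp add: vertex_bilinear_def laurent_bilinear_def)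
    then show ?thesis
      using v by (subst linear_maps_cong[OF IJ M.M.module_axioms]) simp_all
  qed
  moreover have "(\<lambda>w. I u w n) \<in> linear_maps K N' W" if u: "u \<in> carrier M" for u n
  proof -
    have "(\<lambda>v. J u v n) \<in> linear_maps K N W"
      using J u by (simp add: vertex_bilinear_def laurent_bilinear_def)
    \<comment> \<open>Reversing \<open>surj\<close> turns quantifiers over \<open>carrier N'\<close>
      into quantifiers over values \<open>g v\<close>.\<close>
    then show ?thesis
      using u by (simp add: linear_maps_def g_add g_smult Pi_iff IJ flip: surj)
  qed
  ultimately have "laurent_bilinear K M N' W I"
    by (simp add: laurent_bilinear_def flip: surj)
  then show ?thesis
    using J by (simp add: vertex_bilinear_def g_transl g_vop IJ' flip: surj)
qed

text \<open>This is the uniqueness half of the universal property, applied to the bilinear map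
  \<open>\<phi> (F u v n)\<close>, through which both homomorphisms factor. It is the tool for every
  later comparison of maps out of a tensor product.\<close>

lemma tensor_product_hom_eqI:
  fixes T W :: "('k, 'v, 't) vmodule"
  assumes T: "tensor_product K V M N T F" and M: "vertex_module K V M" and N: "vertex_module K V N"
    and W: "vertex_module K V W"
    and \<phi>: "\<phi> \<in> vertex_hom K V T W" and \<psi>: "\<psi> \<in> vertex_hom K V T W"
    and eq: "\<And>u v n. u \<in> carrier M \<Longrightarrow> v \<in> carrier N \<Longrightarrow> \<phi> (F u v n) = \<psi> (F u v n)"
    and x: "x \<in> carrier T"
  shows "\<phi> x = \<psi> x"
proof -
  have vT: "vertex_module K V T" and F: "vertex_bilinear K V M N T F"
    using T by (simp_all add: tensor_product_def)
  have "vertex_bilinear K V M N W (\<lambda>u v n. \<phi> (F u v n))"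
    using M N vT W F \<phi> by (rule vertex_bilinear_compose)
  then have ex1: "\<exists>!\<chi>. \<chi> \<in> vertex_hom K V T W \<and> \<chi> \<in> extensional (carrier T) \<and>
      (\<forall>u\<in>carrier M. \<forall>v\<in>carrier N. \<forall>n. \<phi> (F u v n) = \<chi> (F u v n))"
    using T W unfolding tensor_product_def by blast
  let ?\<phi> = "restrict \<phi> (carrier T)" and ?\<psi> = "restrict \<psi> (carrier T)"
  have "?\<phi> \<in> vertex_hom K V T W \<and> ?\<phi> \<in> extensional (carrier T) \<and>
      (\<forall>u\<in>carrier M. \<forall>v\<in>carrier N. \<forall>n. \<phi> (F u v n) = ?\<phi> (F u v n))"
    by (simp add: vertex_hom_restrict vT \<phi> vertex_bilinear_closed[OF F])
  moreover have "?\<psi> \<in> vertex_hom K V T W \<and> ?\<psi> \<in> extensional (carrier T) \<and>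
      (\<forall>u\<in>carrier M. \<forall>v\<in>carrier N. \<forall>n. \<phi> (F u v n) = ?\<psi> (F u v n))"
    by (simp add: vertex_hom_restrict vT \<psi> vertex_bilinear_closed[OF F] eq)
  ultimately have "?\<phi> = ?\<psi>"
    using ex1 by blast
  then show ?thesis
    using x by (metis restrict_apply')
qed

lemma tensor_product_lift:
  fixes T W :: "('k, 'v, 't) vmodule"
  assumes "tensor_product K V M N T F" "vertex_module K V W" "vertex_bilinear K V M N W I"
  obtains \<phi> where "\<phi> \<in> vertex_hom K V T W"
    "\<And>u v n. u \<in> carrier M \<Longrightarrow> v \<in> carrier N \<Longrightarrow> \<phi> (F u v n) = I u v n"
proof -
  have "\<exists>!\<phi>. \<phi> \<in> vertex_hom K V T W \<and> \<phi> \<in> extensional (carrier T) \<and>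
      (\<forall>u\<in>carrier M. \<forall>v\<in>carrier N. \<forall>n. I u v n = \<phi> (F u v n))"
    using assms unfolding tensor_product_def by blast
  then show thesis using that by metis
qed

text \<open>The definite description is meaningful because \<open>F' u (g v)\<close> is vertex
  bilinear on \<open>M\<close> and \<open>N\<close>, so the universal property of \<open>T\<close>
  gives exactly one such map.\<close>

lemma tensor_id_map:
  fixes T T' :: "('k, 'v, 't) vmodule"
  assumes T: "tensor_product K V M N T F" and T': "tensor_product K V M N' T' F'"
    and N: "vertex_module K V N" and g: "g \<in> vertex_hom K V N N'"
  shows "tensor_id_map K V M N T F T' F' g \<in> vertex_hom K V T T'"
    and "\<And>u v n. u \<in> carrier M \<Longrightarrow> v \<in> carrier N \<Longrightarrow>
      tensor_id_map K V M N T F T' F' g (F u v n) = F' u (g v) n"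
proof -
  have "vertex_bilinear K V M N T' (\<lambda>u v. F' u (g v))"
    using N _ g by (rule vertex_bilinear_precompose) (use T' in \<open>simp add: tensor_product_def\<close>)
  then have "\<exists>!\<phi>. \<phi> \<in> vertex_hom K V T T' \<and> \<phi> \<in> extensional (carrier T) \<and>
      (\<forall>u\<in>carrier M. \<forall>v\<in>carrier N. \<forall>n. F' u (g v) n = \<phi> (F u v n))"
    using T T' unfolding tensor_product_def by blast
  then have "\<exists>!\<phi>. \<phi> \<in> vertex_hom K V T T' \<and> \<phi> \<in> extensional (carrier T) \<and>
      (\<forall>u\<in>carrier M. \<forall>v\<in>carrier N. \<forall>n. \<phi> (F u v n) = F' u (g v) n)"
    \<comment> \<open>The universal property and the definition of \<open>tensor_id_map\<close>
      state the equation in opposite directions.\<close>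
    by (simp only: eq_commute)
  from theI'[OF this] show "tensor_id_map K V M N T F T' F' g \<in> vertex_hom K V T T'"
    and "\<And>u v n. u \<in> carrier M \<Longrightarrow> v \<in> carrier N \<Longrightarrow>
      tensor_id_map K V M N T F T' F' g (F u v n) = F' u (g v) n"
    unfolding tensor_id_map_def by blast+
qed

lemma tensor_id_map_surj:
  fixes T T' :: "('k, 'v, 't) vmodule"
  assumes T: "tensor_product K V M N T F" and T': "tensor_product K V M N' T' F'"
    and M: "vertex_module K V M" and N: "vertex_module K V N" and N': "vertex_module K V N'"
    and g: "g \<in> vertex_hom K V N N'" and surj: "g ` carrier N = carrier N'"
  shows "tensor_id_map K V M N T F T' F' g ` carrier T = carrier T'"
proof -
  define \<psi> where "\<psi> = tensor_id_map K V M N T F T' F' g"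
  have \<psi>: "\<psi> \<in> vertex_hom K V T T'"
    and \<psi>_F: "\<And>u v n. u \<in> carrier M \<Longrightarrow> v \<in> carrier N \<Longrightarrow> \<psi> (F u v n) = F' u (g v) n"
    unfolding \<psi>_def using tensor_id_map[OF T T' N g] by blast+
  have vT: "vertex_module K V T" and F: "vertex_bilinear K V M N T F"
    and vT': "vertex_module K V T'" and F': "vertex_bilinear K V M N' T' F'"
    using T T' by (simp_all add: tensor_product_def)
  obtain Q :: "('k, 'v, 't) vmodule" and \<pi> where Q: "vertex_module K V Q"
    and \<pi>: "\<pi> \<in> vertex_hom K V T' Q"
    and \<pi>_iff: "\<And>x. x \<in> carrier T' \<Longrightarrow> \<pi> x = \<zero>\<^bsub>Q\<^esub> \<longleftrightarrow> x \<in> \<psi> ` carrier T"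
    using vertex_cokernel[OF vT vT' \<psi>] by blast
  have "\<pi> (F' u v n) = \<zero>\<^bsub>Q\<^esub>" if u: "u \<in> carrier M" and v: "v \<in> carrier N'" for u v n
  proof -
    \<comment> \<open>Lifting \<open>v\<close> through \<open>g\<close> shows that
      \<open>F' u v n\<close> is a value of \<open>\<psi>\<close>, hence dies in the
      cokernel.\<close>
    obtain w where w: "w \<in> carrier N" "v = g w" using surj v by blast
    then show ?thesis
      using \<pi>_iff[OF vertex_bilinear_closed[OF F' u v]] \<psi>_F[OF u w(1), of n]
        vertex_bilinear_closed[OF F u w(1)] by (metis imageI)
  qed
  then have "\<pi> x = \<zero>\<^bsub>Q\<^esub>" if "x \<in> carrier T'" for x
    using tensor_product_hom_eqI[OF T' M N' Q \<pi> vertex_hom_zero[OF Q]] that by blast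
  then have "carrier T' \<subseteq> \<psi> ` carrier T"
    using \<pi>_iff by blast
  moreover have "\<psi> ` carrier T \<subseteq> carrier T'"
    using \<psi> by (auto simp: vertex_hom_def linear_maps_def)
  ultimately show ?thesis unfolding \<psi>_def by blast
qed

section \<open>Right exactness of the tensor product\<close>

theorem theorem7p6:
  fixes K :: "'k ring"
    and V :: "('k, 'v) valgebra"
    and M :: "('k, 'v, 'm) vmodule"
    and N' :: "('k, 'v, 'n1) vmodule"
    and N :: "('k, 'v, 'n2) vmodule"
    and N'' :: "('k, 'v, 'n3) vmodule"
    and T' T T'' :: "('k, 'v, 't) vmodule"
    and F' :: "'m \<Rightarrow> 'n1 \<Rightarrow> int \<Rightarrow> 't"
    and F :: "'m \<Rightarrow> 'n2 \<Rightarrow> int \<Rightarrow> 't"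
    and F'' :: "'m \<Rightarrow> 'n3 \<Rightarrow> int \<Rightarrow> 't"
    and f :: "'n1 \<Rightarrow> 'n2"
    and g :: "'n2 \<Rightarrow> 'n3"
  assumes "vertex_algebra K V"
    and "right_exact K V N' N N'' f g"
    and "vertex_module K V M"
    and "tensor_product K V M N' T' F'"
    and "tensor_product K V M N T F"
    and "tensor_product K V M N'' T'' F''"
  shows "right_exact K V T' T T''
    (tensor_id_map K V M N' T' F' T F f) (tensor_id_map K V M N T F T'' F'' g)"
proof -
  note M = assms(3) and T' = assms(4) and T = assms(5) and T'' = assms(6)
  have N': "vertex_module K V N'" and N: "vertex_module K V N" and N'': "vertex_module K V N''"
    and f: "f \<in> vertex_hom K V N' N" and g: "g \<in> vertex_hom K V N N''"
    and exact: "f ` carrier N' = a_kernel N N'' g" and surj: "g ` carrier N = carrier N''"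
    using assms(2) by (simp_all add: right_exact_def)
  have vT': "vertex_module K V T'" and F': "vertex_bilinear K V M N' T' F'"
    and vT: "vertex_module K V T" and F: "vertex_bilinear K V M N T F"
    and vT'': "vertex_module K V T''" and F'': "vertex_bilinear K V M N'' T'' F''"
    using T' T T'' by (simp_all add: tensor_product_def)
  define \<alpha> where "\<alpha> = tensor_id_map K V M N' T' F' T F f"
  define \<beta> where "\<beta> = tensor_id_map K V M N T F T'' F'' g"
  have \<alpha>: "\<alpha> \<in> vertex_hom K V T' T"
    and \<alpha>_F': "\<And>u v n. u \<in> carrier M \<Longrightarrow> v \<in> carrier N' \<Longrightarrow> \<alpha> (F' u v n) = F u (f v) n"
    unfolding \<alpha>_def using tensor_id_map[OF T' T N' f] by blast+
  have \<beta>: "\<beta> \<in> vertex_hom K V T T''"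
    and \<beta>_F: "\<And>u v n. u \<in> carrier M \<Longrightarrow> v \<in> carrier N \<Longrightarrow> \<beta> (F u v n) = F'' u (g v) n"
    unfolding \<beta>_def using tensor_id_map[OF T T'' N g] by blast+
  have ker_g: "x \<in> a_kernel N N'' g \<longleftrightarrow> x \<in> carrier N \<and> g x = \<zero>\<^bsub>N''\<^esub>" for x
    by (simp add: a_kernel_def')
  interpret N: vertex_module K V N by fact
  interpret g: linear_map K N N'' g by (rule linear_map_vertex_hom) fact+
  have f_closed: "f v \<in> carrier N" if "v \<in> carrier N'" for v
    using f that by (auto simp: vertex_hom_def linear_maps_def)
  have gf: "g (f v) = \<zero>\<^bsub>N''\<^esub>" if "v \<in> carrier N'" for v
    using exact ker_g that by blast
  have \<alpha>_closed: "\<alpha> x \<in> carrier T" if "x \<in> carrier T'" for x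
    using \<alpha> that by (auto simp: vertex_hom_def linear_maps_def)

  \<comment> \<open>The composite agrees with the zero map on the coefficients of \<open>F'\<close>:
    there it takes the values \<open>F'' u (g (f v)) n\<close>, and \<open>g (f v)\<close> is
    zero.\<close>
  have "\<beta> (\<alpha> x) = \<zero>\<^bsub>T''\<^esub>" if "x \<in> carrier T'" for x
  proof (rule tensor_product_hom_eqI[OF T' M N' vT'' vertex_hom_compose[OF \<alpha> \<beta>]
        vertex_hom_zero[OF vT''] _ that])
    fix u v n assume u: "u \<in> carrier M" and v: "v \<in> carrier N'"
    interpret F'': linear_map K N'' T'' "\<lambda>v. F'' u v n"
      using g.B.module_axioms vertex_module.axioms(2)[OF vT''] F'' u
      by (simp add: linear_map_def linear_map_axioms_def vertex_bilinear_def laurent_bilinear_def)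
    show "\<beta> (\<alpha> (F' u v n)) = \<zero>\<^bsub>T''\<^esub>"
      using u v F''.hom.hom_zero by (simp add: \<alpha>_F' \<beta>_F f_closed gf)
  qed
  then have "\<alpha> ` carrier T' \<subseteq> a_kernel T T'' \<beta>"
    using \<alpha>_closed by (auto simp: a_kernel_def')

  moreover have "a_kernel T T'' \<beta> \<subseteq> \<alpha> ` carrier T'"
  proof -
    obtain Q :: "('k, 'v, 't) vmodule" and \<pi> where Q: "vertex_module K V Q"
      and \<pi>: "\<pi> \<in> vertex_hom K V T Q"
      and \<pi>_iff: "\<And>x. x \<in> carrier T \<Longrightarrow> \<pi> x = \<zero>\<^bsub>Q\<^esub> \<longleftrightarrow> x \<in> \<alpha> ` carrier T'"
      using vertex_cokernel[OF vT' vT \<alpha>] by blast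
    have \<pi>F: "vertex_bilinear K V M N Q (\<lambda>u v n. \<pi> (F u v n))"
      using M N vT Q F \<pi> by (rule vertex_bilinear_compose)
    \<comment> \<open>An arbitrary preimage under \<open>g\<close> is chosen; \<open>I_g\<close>
      shows that the choice does not matter.\<close>
    define I where "I u w = (\<lambda>n. \<pi> (F u (SOME v. v \<in> carrier N \<and> g v = w) n))" for u w
    have I_g: "I u (g v) n = \<pi> (F u v n)" if u: "u \<in> carrier M" and v: "v \<in> carrier N" for u v n
    proof -
      define w where "w = (SOME w. w \<in> carrier N \<and> g w = g v)"
      have w: "w \<in> carrier N" "g w = g v"
        unfolding w_def using someI[of "\<lambda>w. w \<in> carrier N \<and> g w = g v"] v by auto
      interpret \<pi>F: linear_map K N Q "\<lambda>v. \<pi> (F u v n)"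
        using N.M.module_axioms vertex_module.axioms(2)[OF Q] \<pi>F u
        by (simp add: linear_map_def linear_map_axioms_def vertex_bilinear_def laurent_bilinear_def)
      \<comment> \<open>Two preimages differ by an element of the kernel of \<open>g\<close>, hence
        by some \<open>f v'\<close>. Then \<open>F u (f v') n\<close> equals
        \<open>\<alpha> (F' u v' n)\<close>, which \<open>\<pi>\<close> kills.\<close>
      have "w \<ominus>\<^bsub>N\<^esub> v \<in> a_kernel N N'' g"
        using v w g.B.r_neg[of "g v"] by (simp add: ker_g a_minus_def[of N''])
      then obtain v' where v': "v' \<in> carrier N'" "w \<ominus>\<^bsub>N\<^esub> v = f v'"
        using exact by blast
      have "F u (f v') n \<in> \<alpha> ` carrier T'"
        using \<alpha>_F'[OF u v'(1)] vertex_bilinear_closed[OF F' u v'(1)] by (metis imageI)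
      then have "\<pi> (F u (w \<ominus>\<^bsub>N\<^esub> v) n) = \<zero>\<^bsub>Q\<^esub>"
        using \<pi>_iff[OF vertex_bilinear_closed[OF F u f_closed[OF v'(1)]]] v'(2) by simp
      then have "\<pi> (F u ((w \<ominus>\<^bsub>N\<^esub> v) \<oplus>\<^bsub>N\<^esub> v) n) = \<pi> (F u v n)"
        using w v \<pi>F.add[of "w \<ominus>\<^bsub>N\<^esub> v" v] \<pi>F.closed[of v] by simp
      moreover have "(w \<ominus>\<^bsub>N\<^esub> v) \<oplus>\<^bsub>N\<^esub> v = w"
        using w v by (simp add: a_minus_def N.M.a_assoc N.M.l_neg)
      ultimately have "\<pi> (F u w n) = \<pi> (F u v n)"
        by simp
      then show ?thesis by (simp add: I_def w_def)
    qed
    have I: "vertex_bilinear K V M N'' Q I"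
      using M N g surj \<pi>F I_g by (rule vertex_bilinear_descend)
    obtain \<chi> where \<chi>: "\<chi> \<in> vertex_hom K V T'' Q"
      and \<chi>_F'': "\<And>u v n. u \<in> carrier M \<Longrightarrow> v \<in> carrier N'' \<Longrightarrow> \<chi> (F'' u v n) = I u v n"
      using tensor_product_lift[OF T'' Q I] by blast
    \<comment> \<open>Both sides send \<open>F u v n\<close> to \<open>\<pi> (F u v n)\<close>, so
      uniqueness for \<open>T\<close> identifies them.\<close>
    have \<chi>_\<beta>: "\<chi> (\<beta> x) = \<pi> x" if "x \<in> carrier T" for x
      by (rule tensor_product_hom_eqI[OF T M N Q vertex_hom_compose[OF \<beta> \<chi>] \<pi> _ that])
         (simp add: \<beta>_F \<chi>_F'' I_g)
    interpret \<chi>: linear_map K T'' Q \<chi> by (rule linear_map_vertex_hom) fact+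
    \<comment> \<open>If \<open>\<beta> x\<close> vanishes, then so does \<open>\<pi> x\<close>,
      being \<open>\<chi>\<close> of it, and the kernel of \<open>\<pi>\<close> is the image of
      \<open>\<alpha>\<close>.\<close>
    have "x \<in> \<alpha> ` carrier T'" if "x \<in> carrier T" "\<beta> x = \<zero>\<^bsub>T''\<^esub>" for x
      using \<pi>_iff[OF that(1)] \<chi>_\<beta>[OF that(1)] that(2) \<chi>.hom.hom_zero by simp
    then show ?thesis by (auto simp: a_kernel_def')
  qed
  moreover have "\<beta> ` carrier T = carrier T''"
    unfolding \<beta>_def using T T'' M N N'' g surj by (rule tensor_id_map_surj)
  ultimately show ?thesis
    using vT' vT vT'' \<alpha> \<beta> unfolding right_exact_def \<alpha>_def \<beta>_def by blast
qed

end
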